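(* The diversity-aware $k$-median problem (\textsc{Div-$k$-Median}) is fixed-parameter intractable with respect to the parameter $k$ (the size of the solution sought): assuming the Dominating Set problem parameterized by solution size is not fixed-parameter tractable, there is no algorithm solving every instance of \textsc{Div-$k$-Median} in time $f(k)\cdot |x|^{O(1)}$, where $|x|$ is the input size and $f$ is any computable function depending only on $k$.
   Context: An instance of the diversity-aware $k$-median problem (\textsc{Div-$k$-Median}) consists of a finite set of clients $C$, a finite set of facilities $\mathcal{P}$, a distance function $d: C\times\mathcal{P}\to\mathbb{R}_{\ge 0}$, a collection $\mathcal{F}=\{F_1,\dots,F_t\}$ of facility groups $F_i\subseteq\mathcal{P}$ (which may overlap), an integer budget $k$, and lower-bound thresholds $R=\{r_1,\dots,r_t\}$ (nonnegative integers, one per group). A feasible solution is a set $S\subseteq\mathcal{P}$ with $|S|=k$ and $|S\cap F_i|\ge r_i$ for all $i\in[t]$. The problem asks for a feasible $S$ minimizing $\sum_{c\in C}\min_{s\in S} d(c,s)$. The Dominating Set problem: given a graph $G=(V,E)$ and integer $k$, decide whether there is $S\subseteq V$, $|S|=k$, such that every vertex is in $S$ or adjacent to a vertex of $S$. *)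

theory Defs
  imports Complex_Main
begin

text \<open>
  Algorithms are structured programs operating on finitely many stacks over a fixed finite
  alphabet.  Every elementary operation and every test costs one time unit.  A Turing tape
  is a pair of stacks, a stack is a tape, and the state of a Turing machine can be kept on a stack,
  so these programs and multi-tape Turing machines simulate each other with constant-factor
  overhead.
\<close>

datatype sym = Zero | One | Sep

datatype com =
    Skip
  | Push nat sym
  | Pop nat
  | Seq com com
  | Cond nat "sym option set" com com
  | Loop nat "sym option set" com

type_synonym store = "nat \<Rightarrow> sym list"

definition top_sym :: "store \<Rightarrow> nat \<Rightarrow> sym option" where
  "top_sym s r = (case s r of [] \<Rightarrow> None | a # _ \<Rightarrow> Some a)"

text \<open>\<open>exec c s t s'\<close>: started in \<open>s\<close>, the program \<open>c\<close> halts in \<open>s'\<close> after exactly \<open>t\<close> steps.\<close>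

inductive exec :: "com \<Rightarrow> store \<Rightarrow> nat \<Rightarrow> store \<Rightarrow> bool" where
  Skip: "exec Skip s 1 s"
| Push: "exec (Push r a) s 1 (s(r := a # s r))"
| Pop: "exec (Pop r) s 1 (s(r := tl (s r)))"
| Seq: "exec c1 s t1 s1 \<Longrightarrow> exec c2 s1 t2 s2 \<Longrightarrow> exec (Seq c1 c2) s (t1 + t2) s2"
| CondTrue: "top_sym s r \<in> A \<Longrightarrow> exec c1 s t s' \<Longrightarrow> exec (Cond r A c1 c2) s (Suc t) s'"
| CondFalse: "top_sym s r \<notin> A \<Longrightarrow> exec c2 s t s' \<Longrightarrow> exec (Cond r A c1 c2) s (Suc t) s'"
| LoopFalse: "top_sym s r \<notin> A \<Longrightarrow> exec (Loop r A c) s 1 s"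
| LoopTrue: "top_sym s r \<in> A \<Longrightarrow> exec c s t1 s1 \<Longrightarrow> exec (Loop r A c) s1 t2 s2 \<Longrightarrow>
    exec (Loop r A c) s (Suc (t1 + t2)) s2"

inductive_cases exec_SkipE: "exec Skip s t s'"
inductive_cases exec_PushE: "exec (Push r a) s t s'"
inductive_cases exec_PopE: "exec (Pop r) s t s'"
inductive_cases exec_SeqE: "exec (Seq c1 c2) s t s'"
inductive_cases exec_CondE: "exec (Cond r A c1 c2) s t s'"
inductive_cases exec_LoopE: "exec (Loop r A c) s t s'"

lemma exec_deterministic:
  "exec c s t s' \<Longrightarrow> exec c s u s'' \<Longrightarrow> t = u \<and> s' = s''"
proof (induction arbitrary: u s'' rule: exec.induct)
  case (Skip s)
  then show ?case by (rule exec_SkipE) simp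
next
  case (Push r a s)
  then show ?case by (rule exec_PushE) simp
next
  case (Pop r s)
  then show ?case by (rule exec_PopE) simp
next
  case (Seq c1 s t1 s1 c2 t2 s2)
  from Seq.prems show ?case by (rule exec_SeqE) (metis Seq.IH)
next
  case (CondTrue s r A c1 t s' c2)
  from CondTrue.prems show ?case by (rule exec_CondE) (metis CondTrue.IH, metis CondTrue.hyps(1))
next
  case (CondFalse s r A c2 t s' c1)
  from CondFalse.prems show ?case by (rule exec_CondE) (metis CondFalse.hyps(1), metis CondFalse.IH)
next
  case (LoopFalse s r A c)
  from LoopFalse.prems show ?case by (rule exec_LoopE) (simp, metis LoopFalse.hyps)
next
  case (LoopTrue s r A c t1 s1 t2 s2)
  from LoopTrue.prems show ?case by (rule exec_LoopE) (metis LoopTrue.hyps(1), metis LoopTrue.IH)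
qed

text \<open>Input and output are on stack 0; all other stacks are initially empty.\<close>

definition runs :: "com \<Rightarrow> sym list \<Rightarrow> nat \<Rightarrow> sym list \<Rightarrow> bool" where
  "runs c inp t out \<longleftrightarrow> (\<exists>s'. exec c ((\<lambda>_. [])(0 := inp)) t s' \<and> s' 0 = out)"

definition sym_of :: "bool \<Rightarrow> sym" where
  "sym_of b = (if b then One else Zero)"

text \<open>Binary representation, least significant bit first.\<close>

fun nat_bits :: "nat \<Rightarrow> sym list" where
  "nat_bits n = (if n = 0 then [] else sym_of (odd n) # nat_bits (n div 2))"

declare nat_bits.simps [simp del]

definition computable :: "(nat \<Rightarrow> nat) \<Rightarrow> bool" where
  "computable f \<longleftrightarrow> (\<exists>c. \<forall>n. \<exists>t. runs c (nat_bits n) t (nat_bits (f n)))"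

text \<open>
  A parameterized problem is given by its set of instances, their encoding as strings, the
  parameter, and the relation between instances and correct outputs.  Constant factors of
  the polynomial in the input size are absorbed by \<open>f\<close>.
\<close>

definition fixed_parameter_tractable ::
  "'i set \<Rightarrow> ('i \<Rightarrow> sym list) \<Rightarrow> ('i \<Rightarrow> nat) \<Rightarrow> ('i \<Rightarrow> sym list \<Rightarrow> bool) \<Rightarrow> bool" where
  "fixed_parameter_tractable X enc \<kappa> correct \<longleftrightarrow>
     (\<exists>c f e. computable f \<and>
        (\<forall>x\<in>X. \<exists>t out. runs c (enc x) t out \<and> correct x out \<and>
           t \<le> f (\<kappa> x) * length (enc x) ^ e))"

text \<open>Self-delimiting codes for numbers in binary and in unary, bit vectors, and nonnegative rationals.\<close>

definition enc_nat :: "nat \<Rightarrow> sym list" where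
  "enc_nat n = nat_bits n @ [Sep]"

definition enc_unary :: "nat \<Rightarrow> sym list" where
  "enc_unary n = replicate n One @ [Sep]"

definition enc_subset :: "nat \<Rightarrow> nat set \<Rightarrow> sym list" where
  "enc_subset m A = map (\<lambda>i. sym_of (i \<in> A)) [0..<m]"

definition enc_rat :: "rat \<Rightarrow> sym list" where
  "enc_rat q = (case quotient_of q of (a, b) \<Rightarrow> enc_nat (nat a) @ enc_nat (nat b))"


section \<open>Dominating Set\<close>

record 'v ds_instance =
  verts :: "'v set"
  edges :: "'v set set"
  ds_size :: nat

definition ds_wf :: "('v, 'z) ds_instance_scheme \<Rightarrow> bool" where
  "ds_wf G \<longleftrightarrow> finite (verts G) \<and>
     (\<forall>e\<in>edges G. \<exists>u\<in>verts G. \<exists>v\<in>verts G. u \<noteq> v \<and> e = {u, v})"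

definition dominating :: "('v, 'z) ds_instance_scheme \<Rightarrow> 'v set \<Rightarrow> bool" where
  "dominating G S \<longleftrightarrow> S \<subseteq> verts G \<and>
     (\<forall>v\<in>verts G. v \<in> S \<or> (\<exists>u\<in>S. {u, v} \<in> edges G))"

text \<open>Concrete inputs have vertices \<open>0, \<dots>, n - 1\<close> and are given by their adjacency matrix.\<close>

definition ds_instances :: "nat ds_instance set" where
  "ds_instances = {G. ds_wf G \<and> (\<exists>n. verts G = {..<n})}"

definition ds_enc :: "nat ds_instance \<Rightarrow> sym list" where
  "ds_enc G = (let n = card (verts G) in
     enc_nat (ds_size G) @ enc_unary n @
     concat (map (\<lambda>i. enc_subset n {j. {i, j} \<in> edges G} @ [Sep]) [0..<n]))"

definition ds_correct :: "nat ds_instance \<Rightarrow> sym list \<Rightarrow> bool" where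
  "ds_correct G out \<longleftrightarrow> out = [sym_of (\<exists>S. dominating G S \<and> card S = ds_size G)]"


section \<open>Diversity-aware k-median\<close>

text \<open>\<open>groups\<close> lists the pairs \<open>(F\<^sub>i, r\<^sub>i)\<close> of a facility group and its threshold.\<close>

record ('c, 'p) dkm_instance =
  clients :: "'c set"
  facilities :: "'p set"
  distance :: "'c \<Rightarrow> 'p \<Rightarrow> real"
  groups :: "('p set \<times> nat) list"
  budget :: nat

definition dkm_wf :: "('c, 'p, 'z) dkm_instance_scheme \<Rightarrow> bool" where
  "dkm_wf I \<longleftrightarrow> finite (clients I) \<and> finite (facilities I) \<and>
     (\<forall>c\<in>clients I. \<forall>p\<in>facilities I. 0 \<le> distance I c p) \<and>
     (\<forall>(F, r)\<in>set (groups I). F \<subseteq> facilities I)"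

definition dkm_feasible :: "('c, 'p, 'z) dkm_instance_scheme \<Rightarrow> 'p set \<Rightarrow> bool" where
  "dkm_feasible I S \<longleftrightarrow> S \<subseteq> facilities I \<and> card S = budget I \<and>
     (\<forall>(F, r)\<in>set (groups I). r \<le> card (S \<inter> F))"

text \<open>
  For \<open>S = {}\<close> the minimum is unspecified.  This is harmless: the empty set is only compared with
  other sets of cardinality 0, that is, with itself.
\<close>

definition dkm_cost :: "('c, 'p, 'z) dkm_instance_scheme \<Rightarrow> 'p set \<Rightarrow> real" where
  "dkm_cost I S = (\<Sum>c\<in>clients I. Min (distance I c ` S))"

definition dkm_optimal :: "('c, 'p, 'z) dkm_instance_scheme \<Rightarrow> 'p set \<Rightarrow> bool" where
  "dkm_optimal I S \<longleftrightarrow> dkm_feasible I S \<and>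
     (\<forall>S'. dkm_feasible I S' \<longrightarrow> dkm_cost I S \<le> dkm_cost I S')"

text \<open>
  Concrete inputs have clients \<open>0, \<dots>, n - 1\<close>, facilities \<open>0, \<dots>, m - 1\<close> and rational distances,
  since arbitrary reals have no finite representation.
\<close>

definition dkm_instances :: "(nat, nat) dkm_instance set" where
  "dkm_instances = {I. dkm_wf I \<and> (\<exists>n. clients I = {..<n}) \<and> (\<exists>m. facilities I = {..<m}) \<and>
     (\<forall>c\<in>clients I. \<forall>p\<in>facilities I. distance I c p \<in> \<rat>)}"

definition dkm_enc :: "(nat, nat) dkm_instance \<Rightarrow> sym list" where
  "dkm_enc I = (let n = card (clients I); m = card (facilities I) in
     enc_nat (budget I) @ enc_unary m @ enc_unary n @ enc_unary (length (groups I)) @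
     concat (map (\<lambda>c. concat (map (\<lambda>p. enc_rat (THE q. of_rat q = distance I c p)) [0..<m])) [0..<n]) @
     concat (map (\<lambda>(F, r). enc_subset m F @ [Sep] @ enc_nat r) (groups I)))"

text \<open>
  The output is an optimal solution, given by its characteristic vector and flagged by a leading
  \<open>One\<close>, or \<open>[Zero]\<close> if the instance is infeasible.
\<close>

definition dkm_correct :: "(nat, nat) dkm_instance \<Rightarrow> sym list \<Rightarrow> bool" where
  "dkm_correct I out \<longleftrightarrow>
     (if \<exists>S. dkm_feasible I S
      then \<exists>S. dkm_optimal I S \<and> out = One # enc_subset (card (facilities I)) S
      else out = [Zero])"

end

theory Submission
  imports Defs
begin

text \<open>
  A graph is mapped to the instance without clients whose facilities are the vertices and whose
  groups are the closed neighbourhoods, each with threshold 1.  Its feasible solutions are the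
  dominating sets of size \<open>k\<close>, so the leading symbol of the output of an algorithm for
  Div-k-Median answers the Dominating Set question, and the budget is the parameter \<open>k\<close> itself.
  Given adjacency matrices, the reduction copies the input, sets the diagonal entries and inserts
  a constant number of symbols per row, which takes linear time.
\<close>

section \<open>Execution within a time bound\<close>

text \<open>An upper bound in place of the exact step count lets branches of different cost share
  one bound.\<close>

definition exec_within :: "com \<Rightarrow> store \<Rightarrow> nat \<Rightarrow> store \<Rightarrow> bool" where
  "exec_within c s b s' \<longleftrightarrow> (\<exists>t\<le>b. exec c s t s')"

lemma exec_within_mono: "exec_within c s b s' \<Longrightarrow> b \<le> b' \<Longrightarrow> exec_within c s b' s'"
  unfolding exec_within_def using le_trans by blast

lemma exec_within_Skip: "exec_within Skip s 1 s"
  unfolding exec_within_def using exec.Skip by blast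

lemma exec_within_Push: "exec_within (Push r a) s 1 (s(r := a # s r))"
  unfolding exec_within_def using exec.Push by blast

lemma exec_within_Pop: "exec_within (Pop r) s 1 (s(r := tl (s r)))"
  unfolding exec_within_def using exec.Pop by blast

lemma exec_within_Seq:
  "exec_within c1 s b1 s1 \<Longrightarrow> exec_within c2 s1 b2 s2 \<Longrightarrow> exec_within (Seq c1 c2) s (b1 + b2) s2"
  unfolding exec_within_def by (meson add_mono exec.Seq)

lemma exec_within_CondTrue:
  "top_sym s r \<in> A \<Longrightarrow> exec_within c1 s b s' \<Longrightarrow> exec_within (Cond r A c1 c2) s (Suc b) s'"
  unfolding exec_within_def by (meson Suc_le_mono exec.CondTrue)

lemma exec_within_CondFalse:
  "top_sym s r \<notin> A \<Longrightarrow> exec_within c2 s b s' \<Longrightarrow> exec_within (Cond r A c1 c2) s (Suc b) s'"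
  unfolding exec_within_def by (meson Suc_le_mono exec.CondFalse)

lemma exec_within_LoopFalse: "top_sym s r \<notin> A \<Longrightarrow> exec_within (Loop r A c) s 1 s"
  unfolding exec_within_def using exec.LoopFalse by blast

lemma exec_within_LoopTrue:
  "top_sym s r \<in> A \<Longrightarrow> exec_within c s b1 s1 \<Longrightarrow> exec_within (Loop r A c) s1 b2 s2 \<Longrightarrow>
    exec_within (Loop r A c) s (Suc (b1 + b2)) s2"
  unfolding exec_within_def by (meson Suc_le_mono add_mono exec.LoopTrue)

section \<open>Stores with four stacks and straight-line programs\<close>

text \<open>A normal form in which the simplifier can compute updates and compare stores. Index 1
  appears as \<open>Suc 0\<close> in the rules below because the simplifier rewrites it so.\<close>

definition store4 :: "sym list \<Rightarrow> sym list \<Rightarrow> sym list \<Rightarrow> sym list \<Rightarrow> store" where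
  "store4 w x y z = (\<lambda>_. [])(0 := w, 1 := x, 2 := y, 3 := z)"

lemma store4_apply [simp]:
  "store4 w x y z 0 = w" "store4 w x y z (Suc 0) = x"
  "store4 w x y z 2 = y" "store4 w x y z 3 = z"
  by (simp_all add: store4_def)

lemma store4_upd [simp]:
  "(store4 w x y z)(0 := v) = store4 v x y z" "(store4 w x y z)(Suc 0 := v) = store4 w v y z"
  "(store4 w x y z)(2 := v) = store4 w x v z" "(store4 w x y z)(3 := v) = store4 w x y v"
  by (auto simp: store4_def fun_eq_iff)

lemma top_sym_eq [simp]:
  "s r = [] \<Longrightarrow> top_sym s r = None" "s r = a # l \<Longrightarrow> top_sym s r = Some a"
  by (simp_all add: top_sym_def)

text \<open>The closing \<open>Skip\<close> costs one step, which is the trailing 1 in the bounds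
  below.\<close>

fun seqs :: "com list \<Rightarrow> com" where
  "seqs [] = Skip"
| "seqs (c # cs) = Seq c (seqs cs)"

lemma exec_within_seqs_Nil: "exec_within (seqs []) s 1 s"
  by (simp add: exec_within_Skip[simplified])

lemma exec_within_seqs_Cons:
  "exec_within c s b1 s1 \<Longrightarrow> exec_within (seqs cs) s1 b2 s2 \<Longrightarrow>
    exec_within (seqs (c # cs)) s (b1 + b2) s2"
  by (simp add: exec_within_Seq)

text \<open>With the update moved into the premise, backward chaining executes the program
  symbolically from left to right.\<close>

lemma exec_within_seqs_Push:
  "exec_within (seqs cs) (s(r := a # s r)) b s' \<Longrightarrow> exec_within (seqs (Push r a # cs)) s (Suc b) s'"
  using exec_within_seqs_Cons[OF exec_within_Push] by fastforce

lemma exec_within_seqs_Pop: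
  "exec_within (seqs cs) (s(r := tl (s r))) b s' \<Longrightarrow> exec_within (seqs (Pop r # cs)) s (Suc b) s'"
  using exec_within_seqs_Cons[OF exec_within_Pop] by fastforce

lemmas exec_within_straight =
  exec_within_seqs_Push exec_within_seqs_Pop exec_within_seqs_Nil[THEN exec_within_mono]


section \<open>The reduction as a program\<close>

text \<open>A symbol can only be transferred by testing for it and pushing a constant. The last
  branch would also push \<open>Sep\<close> for an empty stack \<open>p\<close>, so it is applied to
  nonempty stacks only.\<close>

definition move_sym :: "nat \<Rightarrow> nat \<Rightarrow> com" where
  "move_sym p q =
     Cond p {Some One} (seqs [Pop p, Push q One])
       (Cond p {Some Zero} (seqs [Pop p, Push q Zero]) (seqs [Pop p, Push q Sep]))"

text \<open>The costliest branch has two tests, a pop, a push and the final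
  \<open>Skip\<close>.\<close>

lemma exec_move_sym:
  assumes "s p = a # l" "p \<noteq> q"
  shows "exec_within (move_sym p q) s 5 (s(p := l, q := a # s q))"
proof (cases a)
  case One
  have "exec_within (move_sym p q) s (Suc (Suc (Suc 1))) (s(p := l, q := a # s q))"
    unfolding move_sym_def using assms One
    by (intro exec_within_CondTrue exec_within_seqs_Pop exec_within_seqs_Push)
      (auto intro: exec_within_seqs_Nil[simplified])
  then show ?thesis by (rule exec_within_mono) simp
next
  case Zero
  have "exec_within (move_sym p q) s (Suc (Suc (Suc (Suc 1)))) (s(p := l, q := a # s q))"
    unfolding move_sym_def using assms Zero
    by (intro exec_within_CondFalse exec_within_CondTrue exec_within_seqs_Pop exec_within_seqs_Push)
      (auto intro: exec_within_seqs_Nil[simplified])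
  then show ?thesis by (rule exec_within_mono) simp
next
  case Sep
  have "exec_within (move_sym p q) s (Suc (Suc (Suc (Suc 1)))) (s(p := l, q := a # s q))"
    unfolding move_sym_def using assms Sep
    by (intro exec_within_CondFalse exec_within_seqs_Pop exec_within_seqs_Push)
      (auto intro: exec_within_seqs_Nil[simplified])
  then show ?thesis by (rule exec_within_mono) simp
qed

text \<open>The assumption on \<open>l\<close> stops the loop exactly at the end of
  \<open>xs\<close>. Each symbol costs 5 steps for the move and 1 for the test; the failing test
  adds 1. Stacks reverse the block.\<close>

lemma exec_move_loop:
  assumes "p \<noteq> q" "set xs \<subseteq> A" "top_sym (s(p := l)) p \<notin> Some ` A" "s p = xs @ l"
  shows "exec_within (Loop p (Some ` A) (move_sym p q)) s (6 * length xs + 1)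
    (s(p := l, q := rev xs @ s q))"
  using assms(2-)
proof (induction xs arbitrary: s)
  case Nil
  then have "s(p := l, q := rev [] @ s q) = s" by auto
  moreover have "exec_within (Loop p (Some ` A) (move_sym p q)) s 1 s"
    using Nil by (intro exec_within_LoopFalse) (auto simp: top_sym_def)
  ultimately show ?case by (simp del: fun_upd_apply)
next
  case (Cons a xs)
  let ?s = "s(p := xs @ l, q := a # s q)"
  have "exec_within (move_sym p q) s 5 ?s"
    using Cons.prems assms(1) by (intro exec_move_sym) auto
  moreover have "exec_within (Loop p (Some ` A) (move_sym p q)) ?s (6 * length xs + 1)
    (?s(p := l, q := rev xs @ ?s q))"
    using Cons.prems assms(1) by (intro Cons.IH) (auto simp: top_sym_def)
  moreover have "top_sym s p \<in> Some ` A" using Cons.prems by (simp add: top_sym_def)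
  ultimately have "exec_within (Loop p (Some ` A) (move_sym p q)) s
      (Suc (5 + (6 * length xs + 1))) (?s(p := l, q := rev xs @ ?s q))"
    by (blast intro: exec_within_LoopTrue)
  moreover have "?s(p := l, q := rev xs @ ?s q) = s(p := l, q := rev (a # xs) @ s q)"
    using assms(1) by auto
  ultimately show ?case by (simp only:) (erule exec_within_mono, simp)
qed

lemma exec_pop_loop:
  assumes "set xs \<subseteq> A" "s p = xs"
  shows "exec_within (Loop p (Some ` A) (Pop p)) s (2 * length xs + 1) (s(p := []))"
  using assms
proof (induction xs arbitrary: s)
  case Nil
  then have "exec_within (Loop p (Some ` A) (Pop p)) s 1 s"
    by (intro exec_within_LoopFalse) (auto simp: top_sym_def)
  moreover from Nil have "s(p := []) = s" by auto
  ultimately show ?case by simp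
next
  case (Cons a xs)
  have "exec_within (Pop p) s 1 (s(p := xs))"
    using exec_within_Pop[of p s] Cons.prems by simp
  moreover have "exec_within (Loop p (Some ` A) (Pop p)) (s(p := xs)) (2 * length xs + 1) (s(p := []))"
    using Cons.IH[of "s(p := xs)", OF _ fun_upd_same] Cons.prems by (simp del: fun_upd_apply)
  moreover have "top_sym s p \<in> Some ` A" using Cons.prems by (simp add: top_sym_def)
  ultimately have "exec_within (Loop p (Some ` A) (Pop p)) s (Suc (1 + (2 * length xs + 1))) (s(p := []))"
    by (blast intro: exec_within_LoopTrue)
  then show ?case by (rule exec_within_mono) simp
qed

section \<open>Bit vectors\<close>

abbreviation bits :: "sym set" where
  "bits \<equiv> {Zero, One}"

lemma set_enc_subset: "set (enc_subset m A) \<subseteq> bits"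
  by (auto simp: enc_subset_def sym_of_def)

lemma set_nat_bits: "set (nat_bits n) \<subseteq> bits"
proof (induction n rule: nat_bits.induct)
  case (1 n)
  then show ?case by (subst nat_bits.simps) (auto simp: sym_of_def)
qed

lemma length_enc_subset [simp]: "length (enc_subset m A) = m"
  by (simp add: enc_subset_def)

text \<open>Only bit \<open>i\<close> depends on the insertion, so both vectors share the part
  before and the part after it.\<close>

lemma enc_subset_insert:
  assumes "i < n"
  obtains xs a ys where "enc_subset n A = xs @ a # ys" "enc_subset n (insert i A) = xs @ One # ys"
    "length xs = i" "Suc (i + length ys) = n"
proof
  have *: "[0..<n] = [0..<i] @ i # [Suc i..<n]"
    using assms by (metis add.left_neutral le0 less_imp_le_nat le_add_diff_inverse upt_add_eq_append upt_conv_Cons)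
  let ?f = "\<lambda>j. sym_of (j \<in> A)"
  show "enc_subset n A = map ?f [0..<i] @ ?f i # map ?f [Suc i..<n]"
    by (simp add: enc_subset_def *)
  show "enc_subset n (insert i A) = map ?f [0..<i] @ One # map ?f [Suc i..<n]"
    by (auto simp: enc_subset_def * sym_of_def)
qed (use assms in auto)

section \<open>Converting the adjacency matrix row by row\<close>

text \<open>Stack 0 holds the input, stack 1 the reversed output and stack 2 the row number in unary.\<close>

definition skip_to_diagonal :: com where
  "skip_to_diagonal = Loop 2 (Some ` {One}) (seqs [Pop 2, Push 3 One, move_sym 0 1])"

text \<open>The row number is used up as a counter, and its copy on stack 3 allows restoring it. A
  round costs 1 for the test and 8 for the body.\<close>

lemma exec_skip_to_diagonal:
  "exec_within skip_to_diagonal (store4 (xs @ w) x (replicate (length xs) One) z) (9 * length xs + 1)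
     (store4 w (rev xs @ x) [] (replicate (length xs) One @ z))"
proof (induction xs arbitrary: x z)
  case Nil
  show ?case unfolding skip_to_diagonal_def
    using exec_within_LoopFalse[of "store4 w x [] z" 2 "Some ` {One}"] by simp
next
  case (Cons a xs)
  let ?n = "length xs"
  let ?s = "store4 (xs @ w) (a # x) (replicate ?n One) (One # z)"
  have "exec_within (move_sym 0 1) (store4 ((a # xs) @ w) x (replicate ?n One) (One # z)) 5 ?s"
    using exec_move_sym[of "store4 ((a # xs) @ w) x (replicate ?n One) (One # z)" 0 a "xs @ w" 1]
    by simp
  from exec_within_seqs_Cons[OF this exec_within_seqs_Nil]
  have "exec_within (seqs [Pop 2, Push 3 One, move_sym 0 1])
      (store4 ((a # xs) @ w) x (replicate (length (a # xs)) One) z) (Suc (Suc 6)) ?s"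
    by (intro exec_within_straight) simp
  moreover have "exec_within skip_to_diagonal ?s (9 * ?n + 1)
      (store4 w (rev xs @ a # x) [] (replicate ?n One @ One # z))"
    by (rule Cons.IH)
  ultimately have "exec_within skip_to_diagonal
      (store4 ((a # xs) @ w) x (replicate (length (a # xs)) One) z) (Suc (Suc (Suc 6) + (9 * ?n + 1)))
      (store4 w (rev xs @ a # x) [] (replicate ?n One @ One # z))"
    unfolding skip_to_diagonal_def by (intro exec_within_LoopTrue) auto
  moreover have "replicate ?n One @ One # z = replicate (length (a # xs)) One @ z"
    by (simp add: replicate_app_Cons_same)
  ultimately show ?case by simp
qed

text \<open>The first pop and push overwrite the diagonal entry, as a vertex dominates itself. The
  pushes after the row produce its separator and the threshold code \<open>enc_nat 1\<close>. The
  end restores the row number and increments it.\<close>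

definition convert_row :: com where
  "convert_row = seqs
     [skip_to_diagonal, Pop 0, Push 1 One, Loop 0 (Some ` bits) (move_sym 0 1),
      Pop 0, Push 1 Sep, Push 1 One, Push 1 Sep,
      Loop 3 (Some ` {One}) (move_sym 3 2), Push 2 One]"

text \<open>A symbol before the diagonal costs 9 steps on the way and 6 for restoring the counter, a
  symbol after it only 6; hence the factor 15.\<close>

lemma exec_convert_row:
  assumes "i < n"
  shows "exec_within convert_row
    (store4 (enc_subset n A @ [Sep] @ w) x (replicate i One) []) (15 * n + 20)
    (store4 w (rev (enc_subset n (insert i A) @ [Sep] @ enc_nat 1) @ x) (replicate (Suc i) One) [])"
proof -
  obtain xs a ys where xs: "enc_subset n A = xs @ a # ys"
    "enc_subset n (insert i A) = xs @ One # ys" "length xs = i" and n: "Suc (i + length ys) = n"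
    using enc_subset_insert[OF assms] .
  have ys: "set ys \<subseteq> bits" using set_enc_subset[of n A] xs(1) by auto
  have one: "enc_nat 1 = [One, Sep]" by (simp add: enc_nat_def nat_bits.simps sym_of_def)
  let ?ones = "replicate i One"
  let ?x = "rev (enc_subset n (insert i A) @ [Sep] @ enc_nat 1) @ x"
  \<comment> \<open>Facts 1 to 3 treat the three loops; 4, 5 and 6 are ever longer tails of the
    program, and 3 followed by 6 is the whole row.\<close>
  have 1: "exec_within (Loop 3 (Some ` {One}) (move_sym 3 2)) (store4 w ?x [] ?ones) (6 * i + 1)
    (store4 w ?x ?ones [])"
    using exec_move_loop[of 3 2 ?ones "{One}" "store4 w ?x [] ?ones" "[]"]
    by (simp add: top_sym_def subset_iff)
  have 2: "exec_within (Loop 0 (Some ` bits) (move_sym 0 1))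
      (store4 (ys @ Sep # w) (One # rev xs @ x) [] ?ones) (6 * length ys + 1)
      (store4 (Sep # w) (rev ys @ One # rev xs @ x) [] ?ones)"
    using exec_move_loop[OF _ ys, of 0 1 "store4 (ys @ Sep # w) (One # rev xs @ x) [] ?ones" "Sep # w"]
    by (auto simp: top_sym_def)
  have 3: "exec_within skip_to_diagonal (store4 (xs @ a # ys @ Sep # w) x ?ones [])
      (9 * i + 1) (store4 (a # ys @ Sep # w) (rev xs @ x) [] ?ones)"
    using exec_skip_to_diagonal[of xs "a # ys @ Sep # w" x "[]"] xs(3) by simp
  have 4: "exec_within (seqs [Push 2 One]) (store4 w ?x ?ones []) (Suc 1)
      (store4 w ?x (replicate (Suc i) One) [])"
    by (intro exec_within_seqs_Push) (use exec_within_seqs_Nil in simp)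
  have 5: "exec_within (seqs [Pop 0, Push 1 Sep, Push 1 One, Push 1 Sep,
      Loop 3 (Some ` {One}) (move_sym 3 2), Push 2 One])
      (store4 (Sep # w) (rev ys @ One # rev xs @ x) [] ?ones) (Suc (Suc (Suc (Suc (6 * i + 1 + Suc 1)))))
      (store4 w ?x (replicate (Suc i) One) [])"
    using exec_within_seqs_Cons[OF 1 4] by (intro exec_within_straight) (simp add: xs one[simplified])
  have 6: "exec_within (seqs [Pop 0, Push 1 One, Loop 0 (Some ` bits) (move_sym 0 1),
      Pop 0, Push 1 Sep, Push 1 One, Push 1 Sep,
      Loop 3 (Some ` {One}) (move_sym 3 2), Push 2 One])
      (store4 (a # ys @ Sep # w) (rev xs @ x) [] ?ones)
      (Suc (Suc (6 * length ys + 1 + Suc (Suc (Suc (Suc (6 * i + 1 + Suc 1)))))))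
      (store4 w ?x (replicate (Suc i) One) [])"
    using exec_within_seqs_Cons[OF 2 5] by (intro exec_within_straight) simp
  have "enc_subset n A @ [Sep] @ w = xs @ a # ys @ Sep # w" by (simp add: xs)
  with exec_within_seqs_Cons[OF 3 6] show ?thesis
    unfolding convert_row_def by (simp only:) (erule exec_within_mono, use n in simp)
qed

text \<open>Every remaining row starts with a bit, so the test fails exactly when the matrix is
  exhausted.\<close>

definition convert_rows :: com where
  "convert_rows = Loop 0 (Some ` bits) convert_row"

text \<open>Induction from \<open>n\<close> down to \<open>i\<close>: the start row is general
  because stack 2 holds \<open>i\<close> when row \<open>i\<close> begins.\<close>

lemma exec_convert_rows:
  assumes "i \<le> n"
  shows "exec_within convert_rows
    (store4 (concat (map (\<lambda>i. enc_subset n (A i) @ [Sep]) [i..<n])) x (replicate i One) [])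
    ((n - i) * (15 * n + 21) + 1)
    (store4 [] (rev (concat (map (\<lambda>i. enc_subset n (insert i (A i)) @ [Sep] @ enc_nat 1) [i..<n])) @ x)
      (replicate n One) [])"
  using assms
proof (induction i arbitrary: x rule: inc_induct)
  case base
  show ?case unfolding convert_rows_def
    using exec_within_LoopFalse[of "store4 [] x (replicate n One) []" 0 "Some ` bits"] by simp
next
  case (step i)
  let ?w = "\<lambda>i. concat (map (\<lambda>i. enc_subset n (A i) @ [Sep]) [i..<n])"
  let ?s = "store4 (?w i) x (replicate i One) []"
  have w: "?w i = enc_subset n (A i) @ [Sep] @ ?w (Suc i)"
    using step.hyps by (simp add: upt_conv_Cons)
  \<comment> \<open>Here \<open>i < n\<close> enters: the row has at least one bit, so the loop is
    not left early.\<close>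
  have "enc_subset n (A i) \<noteq> []"
    using step.hyps by (metis length_enc_subset list.size(3) not_less0)
  then have top: "top_sym ?s 0 \<in> Some ` bits"
    using set_enc_subset[of n "A i"] unfolding w by (cases "enc_subset n (A i)") auto
  have row: "exec_within convert_row ?s (15 * n + 20)
    (store4 (?w (Suc i)) (rev (enc_subset n (insert i (A i)) @ [Sep] @ enc_nat 1) @ x)
      (replicate (Suc i) One) [])"
    unfolding w using exec_convert_row step.hyps by blast
  have "exec_within convert_rows ?s
      (Suc (15 * n + 20 + ((n - Suc i) * (15 * n + 21) + 1)))
      (store4 [] (rev (concat (map (\<lambda>i. enc_subset n (insert i (A i)) @ [Sep] @ enc_nat 1) [i..<n])) @ x)
        (replicate n One) [])"
    using exec_within_LoopTrue[OF top row step.IH[unfolded convert_rows_def]] step.hyps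
    unfolding convert_rows_def by (simp add: upt_conv_Cons)
  moreover have "(n - i) * (15 * n + 21) = 15 * n + 21 + (n - Suc i) * (15 * n + 21)"
    using step.hyps by (metis Suc_diff_Suc mult_Suc)
  ultimately show ?case by (elim exec_within_mono) simp
qed

section \<open>The header and the complete reduction\<close>

text \<open>The number of vertices is written twice, as number of facilities and as number of
  groups; stack 2 keeps the second copy.\<close>

definition copy_unary :: com where
  "copy_unary = Loop 0 (Some ` {One}) (seqs [Push 2 One, move_sym 0 1])"

lemma exec_copy_unary:
  "exec_within copy_unary (store4 (replicate n One @ Sep # w) x y z) (8 * n + 1)
     (store4 (Sep # w) (replicate n One @ x) (replicate n One @ y) z)"
proof (induction n arbitrary: x y)
  case 0
  show ?case unfolding copy_unary_def
    using exec_within_LoopFalse[of "store4 (Sep # w) x y z" 0 "Some ` {One}"] by simp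
next
  case (Suc n)
  let ?w = "replicate n One @ Sep # w"
  let ?s = "store4 (One # ?w) x y z"
  have "exec_within (move_sym 0 1) (store4 (One # ?w) x (One # y) z) 5
      (store4 ?w (One # x) (One # y) z)"
    using exec_move_sym[of "store4 (One # ?w) x (One # y) z" 0 One ?w 1] by simp
  from exec_within_seqs_Cons[OF this exec_within_seqs_Nil]
  have body: "exec_within (seqs [Push 2 One, move_sym 0 1]) ?s (Suc 6)
      (store4 ?w (One # x) (One # y) z)"
    by (intro exec_within_straight) simp
  have top: "top_sym ?s 0 \<in> Some ` {One}" by simp
  show ?case
    using exec_within_LoopTrue[OF top body Suc.IH[unfolded copy_unary_def]]
    unfolding copy_unary_def by (simp add: replicate_app_Cons_same)
qed

text \<open>The second of two consecutive \<open>Sep\<close> is \<open>enc_unary 0\<close>, the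
  number of clients. The last two loops clear the row counter and reverse the output onto stack 0,
  leaving a valid initial store for the next program.\<close>

definition reduction :: com where
  "reduction = seqs
     [Loop 0 (Some ` bits) (move_sym 0 1), move_sym 0 1, copy_unary,
      Pop 0, Push 1 Sep, Push 1 Sep, Loop 2 (Some ` {One}) (move_sym 2 1), Push 1 Sep,
      convert_rows, Loop 2 (Some ` {One}) (Pop 2), Loop 1 (Some ` UNIV) (move_sym 1 0)]"

text \<open>The time is linear because the matrix alone has \<open>n * (n + 1)\<close> symbols,
  which pays for \<open>n\<close> rows of cost linear in \<open>n\<close>. The two length bounds
  serve the time analysis of the steps after the reduction.\<close>

lemma exec_reduction:
  fixes n k :: nat and A :: "nat \<Rightarrow> nat set"
  defines "v \<equiv> enc_nat k @ enc_unary n @ concat (map (\<lambda>i. enc_subset n (A i) @ [Sep]) [0..<n])"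
    and "w \<equiv> enc_nat k @ enc_unary n @ enc_unary 0 @ enc_unary n @
      concat (map (\<lambda>i. enc_subset n (insert i (A i)) @ [Sep] @ enc_nat 1) [0..<n])"
  shows "exec_within reduction (store4 v [] [] []) (100 * length v) (store4 w [] [] [])"
    and "length w \<le> 4 * length v" and "n < length v"
proof -
  let ?K = "nat_bits k" and ?ones = "replicate n One"
  let ?V = "concat (map (\<lambda>i. enc_subset n (A i) @ [Sep]) [0..<n])"
  let ?W = "concat (map (\<lambda>i. enc_subset n (insert i (A i)) @ [Sep] @ enc_nat 1) [0..<n])"
  let ?x = "Sep # rev ?K"
  let ?y = "Sep # ?ones @ Sep # Sep # ?ones @ ?x"
  have one: "length (enc_nat 1) = 2" by (simp add: enc_nat_def nat_bits.simps)
  have v: "v = ?K @ Sep # ?ones @ Sep # ?V"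
    by (simp add: v_def enc_nat_def enc_unary_def)
  have w: "rev (rev ?W @ ?y) = w"
    by (simp add: w_def enc_nat_def enc_unary_def)
  have len_v: "length v = length ?K + n + 2 + n * (n + 1)"
    by (simp add: v length_concat comp_def sum_list_triv)
  have len_w: "length w = length ?K + 2 * n + 4 + n * (n + 3)"
    using one unfolding w_def by (simp add: enc_nat_def enc_unary_def length_concat comp_def sum_list_triv algebra_simps)
  show "length w \<le> 4 * length v" "n < length v"
    unfolding len_v len_w by (simp_all add: algebra_simps)
  have 1: "exec_within (Loop 0 (Some ` bits) (move_sym 0 1)) (store4 v [] [] []) (6 * length ?K + 1)
      (store4 (Sep # ?ones @ Sep # ?V) (rev ?K) [] [])"
    using exec_move_loop[OF _ set_nat_bits, of 0 1 "store4 v [] [] []" "Sep # ?ones @ Sep # ?V"]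
    by (auto simp: top_sym_def v)
  have 2: "exec_within (move_sym 0 1) (store4 (Sep # ?ones @ Sep # ?V) (rev ?K) [] []) 5
      (store4 (?ones @ Sep # ?V) ?x [] [])"
    using exec_move_sym[of "store4 (Sep # ?ones @ Sep # ?V) (rev ?K) [] []" 0 _ _ 1] by simp
  have 3: "exec_within copy_unary (store4 (?ones @ Sep # ?V) ?x [] []) (8 * n + 1)
      (store4 (Sep # ?V) (?ones @ ?x) ?ones [])"
    using exec_copy_unary[of n ?V ?x "[]" "[]"] by simp
  have 4: "exec_within (Loop 2 (Some ` {One}) (move_sym 2 1))
      (store4 ?V (Sep # Sep # ?ones @ ?x) ?ones []) (6 * n + 1)
      (store4 ?V (?ones @ Sep # Sep # ?ones @ ?x) [] [])"
    using exec_move_loop[of 2 1 ?ones "{One}" "store4 ?V (Sep # Sep # ?ones @ ?x) ?ones []" "[]"]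
    by (simp add: top_sym_def subset_iff)
  \<comment> \<open>Moving the ones away in 4 has emptied stack 2, which is row number 0 in
    unary.\<close>
  have 5: "exec_within convert_rows (store4 ?V ?y [] []) (n * (15 * n + 21) + 1)
      (store4 [] (rev ?W @ ?y) ?ones [])"
    using exec_convert_rows[of 0 n A ?y] by simp
  have 6: "exec_within (Loop 2 (Some ` {One}) (Pop 2)) (store4 [] (rev ?W @ ?y) ?ones []) (2 * n + 1)
      (store4 [] (rev ?W @ ?y) [] [])"
    using exec_pop_loop[of ?ones "{One}" "store4 [] (rev ?W @ ?y) ?ones []" 2] by (simp add: subset_iff)
  have "length (rev ?W @ ?y) = length w" using w by (metis length_rev)
  then have 7: "exec_within (Loop 1 (Some ` UNIV) (move_sym 1 0)) (store4 [] (rev ?W @ ?y) [] [])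
      (6 * length w + 1) (store4 w [] [] [])"
    using exec_move_loop[of 1 0 "rev ?W @ ?y" UNIV "store4 [] (rev ?W @ ?y) [] []" "[]"]
    unfolding w by (simp add: top_sym_def del: length_append rev_append)
  have 8: "exec_within (seqs [Push 1 Sep, convert_rows, Loop 2 (Some ` {One}) (Pop 2),
      Loop 1 (Some ` UNIV) (move_sym 1 0)])
      (store4 ?V (?ones @ Sep # Sep # ?ones @ ?x) [] [])
      (Suc (n * (15 * n + 21) + 1 + (2 * n + 1 + (6 * length w + 1 + 1)))) (store4 w [] [] [])"
    using exec_within_seqs_Cons[OF 5 exec_within_seqs_Cons[OF 6
        exec_within_seqs_Cons[OF 7 exec_within_seqs_Nil]]]
    by (intro exec_within_seqs_Push) simp
  have 9: "exec_within (seqs [Pop 0, Push 1 Sep, Push 1 Sep, Loop 2 (Some ` {One}) (move_sym 2 1),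
      Push 1 Sep, convert_rows, Loop 2 (Some ` {One}) (Pop 2), Loop 1 (Some ` UNIV) (move_sym 1 0)])
      (store4 (Sep # ?V) (?ones @ ?x) ?ones [])
      (Suc (Suc (Suc (6 * n + 1 + Suc (n * (15 * n + 21) + 1 + (2 * n + 1 + (6 * length w + 1 + 1)))))))
      (store4 w [] [] [])"
    using exec_within_seqs_Cons[OF 4 8]
    by (intro exec_within_seqs_Push exec_within_seqs_Pop) simp
  show "exec_within reduction (store4 v [] [] []) (100 * length v) (store4 w [] [] [])"
    unfolding reduction_def
    by (rule exec_within_mono[OF exec_within_seqs_Cons[OF 1 exec_within_seqs_Cons[OF 2
          exec_within_seqs_Cons[OF 3 9]]]])
      (unfold len_v len_w, simp add: algebra_simps)
qed

section \<open>Extracting the yes/no answer\<close>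

text \<open>A leading \<open>One\<close> is followed by a characteristic vector to be erased,
  whereas \<open>[Zero]\<close> is already the answer.\<close>

definition first_sym :: com where
  "first_sym = Cond 0 {Some One} (seqs [Loop 0 (Some ` bits) (Pop 0), Push 0 One]) Skip"

text \<open>The store is arbitrary apart from stack 0, since the preceding algorithm may leave
  anything on the other stacks.\<close>

lemma exec_first_sym:
  assumes "s 0 = a # xs" "set (a # xs) \<subseteq> bits" "a = One \<or> xs = []"
  shows "\<exists>s'. exec_within first_sym s (2 * length xs + 6) s' \<and> s' 0 = [a]"
proof (cases "a = One")
  case True
  have "exec_within (seqs [Push 0 One]) (s(0 := [])) (Suc 1) ((s(0 := []))(0 := [One]))"
    by (intro exec_within_seqs_Push) (use exec_within_seqs_Nil in simp)
  from exec_within_seqs_Cons[OF exec_pop_loop[of "a # xs" bits s 0, OF assms(2,1)] this]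
  have "exec_within first_sym s (Suc (2 * length (a # xs) + 1 + Suc 1)) ((s(0 := []))(0 := [One]))"
    unfolding first_sym_def using True assms(1) by (intro exec_within_CondTrue) auto
  then have "exec_within first_sym s (2 * length xs + 6) ((s(0 := []))(0 := [One]))"
    by (rule exec_within_mono) simp
  then show ?thesis using True by (metis fun_upd_same)
next
  case False
  then have "exec_within first_sym s (Suc 1) s"
    unfolding first_sym_def using assms(1)
    by (intro exec_within_CondFalse exec_within_Skip) auto
  then have "exec_within first_sym s (2 * length xs + 6) s"
    by (rule exec_within_mono) simp
  then show ?thesis using False assms by blast
qed


section \<open>Correctness of the reduction\<close>

text \<open>The groups are listed in the order of the matrix rows, so the two encodings correspond
  row by row.\<close>

definition dkm_of_ds :: "nat ds_instance \<Rightarrow> (nat, nat) dkm_instance" where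
  "dkm_of_ds G = \<lparr>clients = {}, facilities = verts G, distance = (\<lambda>_ _. 0),
     groups = map (\<lambda>i. (insert i {j. {i, j} \<in> edges G}, 1)) [0..<card (verts G)],
     budget = ds_size G\<rparr>"

lemma dkm_of_ds_instance:
  assumes "G \<in> ds_instances"
  shows "dkm_of_ds G \<in> dkm_instances"
proof -
  obtain n where n: "verts G = {..<n}" and wf: "ds_wf G"
    using assms unfolding ds_instances_def by blast
  \<comment> \<open>Well-formed edges have both ends in the graph, so groups consist of
    facilities.\<close>
  have "j \<in> verts G" if "{i, j} \<in> edges G" for i j
  proof -
    have "\<exists>u\<in>verts G. \<exists>v\<in>verts G. u \<noteq> v \<and> {i, j} = {u, v}"
      using wf that unfolding ds_wf_def by simp
    then show ?thesis by (auto simp: doubleton_eq_iff)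
  qed
  then have "insert i {j. {i, j} \<in> edges G} \<subseteq> verts G" if "i < n" for i
    using n that by auto
  then have "dkm_wf (dkm_of_ds G)"
    using n by (auto simp: dkm_wf_def dkm_of_ds_def)
  moreover have "clients (dkm_of_ds G) = {..<0}" "facilities (dkm_of_ds G) = {..<n}"
    using n by (simp_all add: dkm_of_ds_def)
  ultimately show ?thesis unfolding dkm_instances_def by fastforce
qed

text \<open>A vertex is dominated exactly if its closed neighbourhood meets
  \<open>S\<close>.\<close>

lemma dkm_of_ds_feasible_iff:
  assumes "G \<in> ds_instances"
  shows "dkm_feasible (dkm_of_ds G) S \<longleftrightarrow> dominating G S \<and> card S = ds_size G"
proof -
  obtain n where n: "verts G = {..<n}" using assms unfolding ds_instances_def by blast
  have "1 \<le> card (S \<inter> insert v {u. {v, u} \<in> edges G}) \<longleftrightarrow> v \<in> S \<or> (\<exists>u\<in>S. {u, v} \<in> edges G)"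
    if "S \<subseteq> verts G" for v
  proof -
    \<comment> \<open>An infinite set would have \<open>card\<close> 0; finiteness turns threshold 1
      into a nonempty intersection.\<close>
    have "finite (S \<inter> insert v {u. {v, u} \<in> edges G})"
      using finite_subset[OF that] n by simp
    then have "1 \<le> card (S \<inter> insert v {u. {v, u} \<in> edges G}) \<longleftrightarrow>
        S \<inter> insert v {u. {v, u} \<in> edges G} \<noteq> {}"
      by (simp only: One_nat_def Suc_le_eq card_gt_0_iff simp_thms)
    also have "\<dots> \<longleftrightarrow> v \<in> S \<or> (\<exists>u\<in>S. {u, v} \<in> edges G)"
      by (auto simp: insert_commute)
    finally show ?thesis .
  qed
  moreover have "dkm_feasible (dkm_of_ds G) S \<longleftrightarrow> S \<subseteq> verts G \<and> card S = ds_size G \<and>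
      (\<forall>v\<in>verts G. 1 \<le> card (S \<inter> insert v {u. {v, u} \<in> edges G}))"
    using n by (simp add: dkm_feasible_def dkm_of_ds_def atLeast0LessThan)
  ultimately show ?thesis unfolding dominating_def by blast
qed

text \<open>Feasibility alone determines the leading symbol; the other facts are what running
  \<open>first_sym\<close> and bounding its time require.\<close>

lemma dkm_of_ds_correct:
  assumes "G \<in> ds_instances" "dkm_correct (dkm_of_ds G) out"
  obtains a xs where "out = a # xs" "set (a # xs) \<subseteq> bits" "a = One \<or> xs = []"
    "length xs \<le> card (verts G)" "ds_correct G [a]"
proof (cases "\<exists>S. dkm_feasible (dkm_of_ds G) S")
  case True
  then obtain S where "out = One # enc_subset (card (verts G)) S"
    using assms(2) by (auto simp: dkm_correct_def dkm_of_ds_def)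
  moreover have "ds_correct G [One]"
    using True dkm_of_ds_feasible_iff[OF assms(1)] by (auto simp: ds_correct_def sym_of_def)
  ultimately show ?thesis using that set_enc_subset by auto
next
  case False
  then have "out = [Zero]" using assms(2) by (auto simp: dkm_correct_def)
  moreover have "ds_correct G [Zero]"
    using False dkm_of_ds_feasible_iff[OF assms(1)] by (auto simp: ds_correct_def sym_of_def)
  ultimately show ?thesis using that by auto
qed

text \<open>Without clients the distance block vanishes, which leaves literally the output string of
  \<open>exec_reduction\<close>.\<close>

lemma dkm_enc_dkm_of_ds:
  "dkm_enc (dkm_of_ds G) = (let n = card (verts G) in
     enc_nat (ds_size G) @ enc_unary n @ enc_unary 0 @ enc_unary n @
     concat (map (\<lambda>i. enc_subset n (insert i {j. {i, j} \<in> edges G}) @ [Sep] @ enc_nat 1) [0..<n]))"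
  by (simp add: dkm_enc_def dkm_of_ds_def Let_def comp_def)


section \<open>Computable upper bounds\<close>

text \<open>
  In the binary representation \<open>m \<mapsto> 2 * m + 1\<close> is a single push, so iterating it gives a computable
  function that absorbs both constant factors and constant summands.
\<close>

lemma computable_double_add_one:
  assumes "computable f"
  shows "computable (\<lambda>n. 2 * f n + 1)"
proof -
  obtain c where c: "\<And>n. \<exists>t. runs c (nat_bits n) t (nat_bits (f n))"
    using assms by (auto simp: computable_def)
  have "\<exists>t. runs (Seq c (Push 0 One)) (nat_bits n) t (nat_bits (2 * f n + 1))" for n
  proof -
    obtain t s where "exec c ((\<lambda>_. [])(0 := nat_bits n)) t s" "s 0 = nat_bits (f n)"
      using c[of n] by (auto simp: runs_def)
    moreover have "nat_bits (2 * f n + 1) = One # nat_bits (f n)"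
      by (subst nat_bits.simps) (simp add: sym_of_def)
    ultimately show ?thesis
      unfolding runs_def using exec.Seq[OF _ exec.Push] by fastforce
  qed
  then show ?thesis unfolding computable_def by blast
qed

lemma computable_affine_bound:
  assumes "computable f"
  shows "computable (\<lambda>n. 2 ^ j * f n + (2 ^ j - 1))"
proof (induction j)
  case 0
  then show ?case using assms by simp
next
  case (Suc j)
  have "2 * (2 ^ j * m + (2 ^ j - 1)) + 1 = 2 ^ Suc j * m + (2 ^ Suc j - 1)" for m :: nat
    \<comment> \<open>Writing \<open>2 ^ j\<close> as a successor removes the truncated
      subtraction.\<close>
    by (cases "2 ^ j :: nat") (simp_all add: algebra_simps)
  with computable_double_add_one[OF Suc.IH] show ?case by simp
qed

section \<open>Transferring tractability back to Dominating Set\<close>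

theorem theorem1:
  assumes "\<not> fixed_parameter_tractable ds_instances ds_enc ds_size ds_correct"
  shows "\<not> fixed_parameter_tractable dkm_instances dkm_enc budget dkm_correct"
proof
  assume "fixed_parameter_tractable dkm_instances dkm_enc budget dkm_correct"
  then obtain c f e where f: "computable f" and c: "\<And>I. I \<in> dkm_instances \<Longrightarrow>
      \<exists>t out. runs c (dkm_enc I) t out \<and> dkm_correct I out \<and> t \<le> f (budget I) * length (dkm_enc I) ^ e"
    unfolding fixed_parameter_tractable_def by metis
  \<comment> \<open>The factor \<open>2 ^ j\<close> absorbs the \<open>4 ^ e\<close> from the growth
    of the input, and the summand \<open>2 ^ j - 1\<close> the linear overhead, even where
    \<open>f k\<close> is 0.\<close>
  define j where "j = 2 * e + 110"
  define g where "g = (\<lambda>k. 2 ^ j * f k + (2 ^ j - 1))"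
  let ?c = "Seq reduction (Seq c first_sym)"
  \<comment> \<open>The exponent \<open>Suc e\<close> leaves room for the linear overhead also when
    \<open>e = 0\<close>.\<close>
  have "\<exists>t out. runs ?c (ds_enc G) t out \<and> ds_correct G out \<and>
      t \<le> g (ds_size G) * length (ds_enc G) ^ Suc e" if G: "G \<in> ds_instances" for G
  proof -
    let ?I = "dkm_of_ds G" and ?L = "length (ds_enc G)" and ?k = "ds_size G"
    note red = exec_reduction[where k = ?k and n = "card (verts G)"
          and A = "\<lambda>i. {j. {i, j} \<in> edges G}",
        folded dkm_enc_dkm_of_ds[unfolded Let_def] ds_enc_def[unfolded Let_def]]
    obtain t out where out: "runs c (dkm_enc ?I) t out" "dkm_correct ?I out"
      and t: "t \<le> f ?k * length (dkm_enc ?I) ^ e"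
      using c[OF dkm_of_ds_instance[OF G]] by (auto simp: dkm_of_ds_def)
    obtain a xs where a: "out = a # xs" "set (a # xs) \<subseteq> bits" "a = One \<or> xs = []"
      and xs: "length xs \<le> card (verts G)" and correct: "ds_correct G [a]"
      using dkm_of_ds_correct[OF G out(2)] .
    have store: "(\<lambda>_. [])(0 := w) = store4 w [] [] []" for w
      by (auto simp: store4_def)
    obtain s where s: "exec c (store4 (dkm_enc ?I) [] [] []) t s" "s 0 = a # xs"
      using out(1) a(1) by (auto simp: runs_def store)
    have "exec_within c (store4 (dkm_enc ?I) [] [] []) t s"
      using s(1) by (auto simp: exec_within_def)
    moreover obtain s' where "exec_within first_sym s (2 * length xs + 6) s'" and s': "s' 0 = [a]"
      using exec_first_sym[of s a xs, OF s(2) a(2,3)] by blast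
    ultimately have "exec_within ?c (store4 (ds_enc G) [] [] [])
        (100 * ?L + (t + (2 * length xs + 6))) s'"
      using red(1) by (intro exec_within_Seq)
    then obtain u where u: "u \<le> 100 * ?L + (t + (2 * length xs + 6))"
      and run: "runs ?c (ds_enc G) u [a]"
      using s' by (auto simp: exec_within_def runs_def store)
    have L: "1 \<le> ?L" using red(3) by simp
    have "t \<le> f ?k * (4 * ?L) ^ e"
      using t power_mono[OF red(2), of e] by (meson le_trans mult_le_mono2 zero_le)
    also have "\<dots> = 2 ^ (2 * e) * f ?k * ?L ^ e"
      by (simp add: power_mult_distrib power_mult)
    also have "\<dots> \<le> 2 ^ j * f ?k * ?L ^ Suc e"
      using L by (intro mult_mono power_increasing) (auto simp: j_def)
    finally have t': "t \<le> 2 ^ j * f ?k * ?L ^ Suc e" .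
    have "110 \<le> (2::nat) ^ j - 1"
      using less_exp[of j] j_def by linarith
    moreover have "?L \<le> ?L ^ Suc e" using L by simp
    ultimately have "110 * ?L \<le> (2 ^ j - 1) * ?L ^ Suc e" by (intro mult_mono) auto
    \<comment> \<open>Since \<open>length xs\<close> is at most the number of vertices, which is
      below \<open>?L\<close>, the term \<open>2 * length xs + 6\<close> is at most
      \<open>10 * ?L\<close>.\<close>
    moreover have "u \<le> 110 * ?L + t" using u xs red(3) by linarith
    ultimately have "u \<le> g ?k * ?L ^ Suc e"
      using t' unfolding g_def add_mult_distrib by linarith
    with run correct show ?thesis by blast
  qed
  moreover have "computable g"
    unfolding g_def using f by (rule computable_affine_bound)
  ultimately show False
    using assms unfolding fixed_parameter_tractable_def by blast
qed

end
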